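(* Let $q$ be a prime power, let $e\geq 2$, and let $R$ be a symplectic spread of $Sp(2e,q)$. Let $\Gamma_{q,e,R}$ be the graph obtained from $Sp(2e,q)$ by removing the edges of the cliques in the spread $R$. Then $\Gamma_{q,e,R}$ is a divisible design graph with parameters $$(v,k,\lambda_1,\lambda_2,m,n)=\left(\frac{q^{2e}-1}{q-1},\ q^e\,\frac{q^{e-1}-1}{q-1},\ q^e\,\frac{q^{e-2}-1}{q-1},\ \frac{(q^{e-1}-1)^2}{q-1},\ q^e+1,\ \frac{q^e-1}{q-1}\right).$$
   Context: A $k$-regular graph on $v$ vertices is a divisible design graph with parameters $(v,k,\lambda_1,\lambda_2,m,n)$ if its vertex set can be partitioned into $m$ classes of size $n$ such that any two distinct vertices from the same class have exactly $\lambda_1$ common neighbours and any two vertices from different classes have exactly $\lambda_2$ common neighbours. Let $\zeta$ be a symplectic polarity of $\mathrm{PG}(2e-1,q)$, i.e. a polarity with $x\in x^\zeta$ for every point $x$. The symplectic graph $Sp(2e,q)$ has the points of $\mathrm{PG}(2e-1,q)$ as vertices, two distinct points $x,y$ being adjacent iff $y\in x^\zeta$. A subspace $\pi$ is totally isotropic if $\pi\subseteq\pi^\zeta$. A symplectic spread is a set of totally isotropic subspaces of projective dimension $e-1$ partitioning the point set of $\mathrm{PG}(2e-1,q)$; it corresponds to a partition of the vertices of $Sp(2e,q)$ into $q^e+1$ cliques of order $(q^e-1)/(q-1)$. *)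

theory Defs
  imports "HOL-Analysis.Cartesian_Space" "HOL-Library.Disjoint_Sets" "HOL-Number_Theory.Prime_Powers"
begin

type_synonym 'v graph = "'v set \<times> 'v set set"

definition simple_graph :: "'v graph \<Rightarrow> bool" where
  "simple_graph G \<longleftrightarrow> finite (fst G) \<and> (\<forall>E\<in>snd G. E \<subseteq> fst G \<and> card E = 2)"

definition neighbours :: "'v graph \<Rightarrow> 'v \<Rightarrow> 'v set" where
  "neighbours G x = {y \<in> fst G. {x, y} \<in> snd G}"

definition regular_graph :: "'v graph \<Rightarrow> nat \<Rightarrow> bool" where
  "regular_graph G k \<longleftrightarrow> (\<forall>x\<in>fst G. card (neighbours G x) = k)"

definition divisible_design_graph ::
    "'v graph \<Rightarrow> nat \<Rightarrow> nat \<Rightarrow> nat \<Rightarrow> nat \<Rightarrow> nat \<Rightarrow> nat \<Rightarrow> bool" where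
  "divisible_design_graph G v k l1 l2 m n \<longleftrightarrow>
     simple_graph G \<and> card (fst G) = v \<and> regular_graph G k \<and>
     (\<exists>P. partition_on (fst G) P \<and> card P = m \<and> (\<forall>C\<in>P. card C = n) \<and>
        (\<forall>C\<in>P. \<forall>x\<in>C. \<forall>y\<in>C. x \<noteq> y \<longrightarrow> card (neighbours G x \<inter> neighbours G y) = l1) \<and>
        (\<forall>C\<in>P. \<forall>D\<in>P. C \<noteq> D \<longrightarrow>
           (\<forall>x\<in>C. \<forall>y\<in>D. card (neighbours G x \<inter> neighbours G y) = l2)))"

(* The subspaces of PG(d-1,q) are the linear subspaces of the d-dimensional vector space
   'a ^ 'n, where CARD('a) = q and CARD('n) = d. The zero space is the empty projective
   subspace, of projective dimension -1. Points are identified with one-dimensional linear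
   subspaces, so incidence of a point with a subspace is inclusion. *)

definition proj_dim :: "('a::field ^ 'n) set \<Rightarrow> int" where
  "proj_dim U = int (vec.dim U) - 1"

definition proj_points :: "('a::field ^ 'n) set set" where
  "proj_points = {x. vec.subspace x \<and> proj_dim x = 0}"

definition points_of :: "('a::field ^ 'n) set \<Rightarrow> ('a ^ 'n) set set" where
  "points_of U = {x \<in> proj_points. x \<subseteq> U}"

(* An inclusion-reversing involution of the lattice of all subspaces; its values on sets
   that are not subspaces are irrelevant. *)
definition polarity :: "(('a::field ^ 'n) set \<Rightarrow> ('a ^ 'n) set) \<Rightarrow> bool" where
  "polarity \<zeta> \<longleftrightarrow>
     (\<forall>U. vec.subspace U \<longrightarrow> vec.subspace (\<zeta> U) \<and> \<zeta> (\<zeta> U) = U) \<and>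
     (\<forall>U W. vec.subspace U \<longrightarrow> vec.subspace W \<longrightarrow> U \<subseteq> W \<longrightarrow> \<zeta> W \<subseteq> \<zeta> U)"

definition symplectic_polarity :: "(('a::field ^ 'n) set \<Rightarrow> ('a ^ 'n) set) \<Rightarrow> bool" where
  "symplectic_polarity \<zeta> \<longleftrightarrow> polarity \<zeta> \<and> (\<forall>x\<in>proj_points. x \<subseteq> \<zeta> x)"

definition symplectic_graph ::
    "(('a::field ^ 'n) set \<Rightarrow> ('a ^ 'n) set) \<Rightarrow> ('a ^ 'n) set graph" where
  "symplectic_graph \<zeta> =
     (proj_points, {{x, y} | x y. x \<in> proj_points \<and> y \<in> proj_points \<and> x \<noteq> y \<and> y \<subseteq> \<zeta> x})"

definition totally_isotropic ::
    "(('a::field ^ 'n) set \<Rightarrow> ('a ^ 'n) set) \<Rightarrow> ('a ^ 'n) set \<Rightarrow> bool" where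
  "totally_isotropic \<zeta> U \<longleftrightarrow> vec.subspace U \<and> U \<subseteq> \<zeta> U"

definition symplectic_spread ::
    "(('a::field ^ 'n) set \<Rightarrow> ('a ^ 'n) set) \<Rightarrow> nat \<Rightarrow> ('a ^ 'n) set set \<Rightarrow> bool" where
  "symplectic_spread \<zeta> e R \<longleftrightarrow>
     (\<forall>U\<in>R. totally_isotropic \<zeta> U \<and> proj_dim U = int e - 1) \<and>
     partition_on proj_points (points_of ` R)"

definition clique_edges :: "'v set \<Rightarrow> 'v set set" where
  "clique_edges C = {{x, y} | x y. x \<in> C \<and> y \<in> C \<and> x \<noteq> y}"

definition spread_removed_graph ::
    "(('a::field ^ 'n) set \<Rightarrow> ('a ^ 'n) set) \<Rightarrow> ('a ^ 'n) set set \<Rightarrow> ('a ^ 'n) set graph" where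
  "spread_removed_graph \<zeta> R =
     (fst (symplectic_graph \<zeta>),
      snd (symplectic_graph \<zeta>) - (\<Union>U\<in>R. clique_edges (points_of U)))"

(* The divisions by q - 1 in the parameters are exact, so they can be taken in nat. *)
lemma minus_one_dvd_power_minus_one: "(q - 1 :: nat) dvd q ^ j - 1"
proof (cases "q = 0")
  case False
  have "int q - 1 dvd int q ^ j - 1"
    by (metis dvd_triv_left power_diff_1_eq)
  with False show ?thesis
    by (simp add: of_nat_diff flip: int_dvd_int_iff)
qed (cases j; simp)

lemma minus_one_dvd_power_minus_one_squared: "(q - 1 :: nat) dvd (q ^ j - 1)\<^sup>2"
  unfolding power2_eq_square by (rule dvd_mult) (rule minus_one_dvd_power_minus_one)

end

(* The polarity is used only as an inclusion-reversing involution of the subspace lattice: it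
   sends dimension j to 2e - j and turns joins into meets. Hence, writing S for the spread
   element through a point x, the neighbours of x are the points of the hyperplane x^zeta
   outside S, and S = S^zeta. Every count is then a number of points of a subspace of known
   dimension; here x^zeta and y^zeta meet in dimension 2e - 2, and for y outside S the subspaces
   S and y^zeta meet in (S + y)^zeta, of dimension e - 1. *)

theory Submission
  imports Defs
begin

section \<open>Counting the points of a subspace\<close>

lemma geometric_sum_eq_div:
  fixes q k :: nat
  assumes "q \<ge> 2"
  shows "(\<Sum>i<k. q ^ i) = (q ^ k - 1) div (q - 1)"
proof -
  have "(q - 1) * (\<Sum>i<k. q ^ i) = q ^ k - 1"
    by (induction k) (use assms in \<open>auto simp: algebra_simps diff_mult_distrib\<close>)
  with assms show ?thesis
    by (metis Suc_1 Suc_le_eq nonzero_mult_div_cancel_left not_less_eq zero_less_diff less_irrefl)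
qed

text \<open>With a = dim U for a subspace U and \<open>a + b\<close> the dimension of a larger one,
  this splits the points of the larger subspace into those of U and the rest. Differences of point
  counts thereby become products, and no truncated subtraction has to be simplified.\<close>

lemma geometric_quotient_add:
  fixes q a b :: nat
  assumes "q \<ge> 2"
  shows "(q ^ (a + b) - 1) div (q - 1) = (q ^ a - 1) div (q - 1) + q ^ a * ((q ^ b - 1) div (q - 1))"
proof -
  have "(\<Sum>i<a + b. q ^ i) = (\<Sum>i<a. q ^ i) + q ^ a * (\<Sum>i<b. q ^ i)"
    by (induction b) (auto simp: algebra_simps power_add)
  then show ?thesis
    using assms by (simp add: geometric_sum_eq_div)
qed

text \<open>Every vector of the larger span is \<open>c *s v + w\<close> for exactly one scalar c
  and one w in \<open>vec.span S\<close>.\<close>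

lemma card_span_insert:
  fixes v :: "'a::{field,finite} ^ 'n::finite"
  assumes "v \<notin> vec.span S"
  shows "card (vec.span (insert v S)) = CARD('a) * card (vec.span S)"
proof -
  let ?f = "\<lambda>(c, w). c *s v + w"
  have "bij_betw ?f (UNIV \<times> vec.span S) (vec.span (insert v S))"
    unfolding bij_betw_def
  proof
    show "inj_on ?f (UNIV \<times> vec.span S)"
    proof (rule inj_onI, clarify)
      fix c c' w w'
      assume w: "w \<in> vec.span S" "w' \<in> vec.span S" and eq: "c *s v + w = c' *s v + w'"
      have "(c - c') *s v = w' - w"
        using eq by (simp add: vec.scale_left_diff_distrib algebra_simps)
      then have "(c - c') *s v \<in> vec.span S"
        using w by (simp add: vec.span_diff)
      \<comment> \<open>If c and c' differed, scaling by the inverse of \<open>c - c'\<close> would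
        put v itself into \<open>vec.span S\<close>.\<close>
      then have "c = c'"
        using assms vec.span_scale[of "(c - c') *s v" S "inverse (c - c')"] by (cases "c = c'") auto
      with eq show "c = c' \<and> w = w'" by simp
    qed
    show "?f ` (UNIV \<times> vec.span S) = vec.span (insert v S)"
    proof
      show "?f ` (UNIV \<times> vec.span S) \<subseteq> vec.span (insert v S)"
        by (auto intro!: vec.span_add intro: vec.span_scale vec.span_base
            vec.span_mono[THEN subsetD, of S "insert v S"])
    next
      show "vec.span (insert v S) \<subseteq> ?f ` (UNIV \<times> vec.span S)"
      proof
        fix x assume "x \<in> vec.span (insert v S)"
        then obtain k where "x - k *s v \<in> vec.span S"
          by (auto simp: vec.span_insert)
        then show "x \<in> ?f ` (UNIV \<times> vec.span S)"
          by (intro image_eqI[of _ _ "(k, x - k *s v)"]) auto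
      qed
    qed
  qed
  from bij_betw_same_card[OF this] show ?thesis
    by (simp add: card_cartesian_product)
qed

lemma card_subspace:
  fixes U :: "('a::{field,finite} ^ 'n::finite) set"
  assumes "vec.subspace U"
  shows "card U = CARD('a) ^ vec.dim U"
proof -
  have *: "card (vec.span B) = CARD('a) ^ card B"
    if "finite B" "vec.independent B" for B :: "('a ^ 'n) set"
    using that
    by (induction B rule: finite_induct) (auto simp: vec.independent_insert card_span_insert)
  obtain B where B: "B \<subseteq> U" "vec.independent B" "U \<subseteq> vec.span B" "card B = vec.dim U"
    using vec.basis_exists by blast
  then have "vec.span B = U"
    using assms by (simp add: vec.span_minimal subset_antisym)
  with *[OF _ B(2)] B(4) show ?thesis by simp
qed

lemma two_le_card_field: "2 \<le> CARD('a::{field,finite})"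
proof -
  have "card {0, 1 :: 'a} \<le> CARD('a)"
    by (intro card_mono) auto
  then show ?thesis by simp
qed

section \<open>Projective points as spans of nonzero vectors\<close>

lemma span_singleton_proj_point:
  assumes "v \<noteq> 0"
  shows "vec.span {v} \<in> proj_points"
  using assms by (simp add: proj_points_def proj_dim_def vec.dim_insert)

lemma proj_point_eq_span:
  assumes "x \<in> proj_points" "v \<in> x" "v \<noteq> 0"
  shows "x = vec.span {v}"
proof (rule vec.subspace_dim_equal[symmetric])
  show "vec.span {v} \<subseteq> x"
    using assms by (intro vec.span_minimal) (auto simp: proj_points_def)
qed (use assms in \<open>auto simp: proj_points_def proj_dim_def vec.dim_insert\<close>)

lemma proj_point_obtain:
  assumes "x \<in> proj_points"
  obtains v where "v \<noteq> 0" "x = vec.span {v}"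
proof -
  have "x \<noteq> {0}" "0 \<in> x"
    using assms by (auto simp: proj_points_def proj_dim_def vec.subspace_0)
  then obtain v where "v \<in> x" "v \<noteq> 0" by blast
  with that proj_point_eq_span[OF assms] show ?thesis by blast
qed

text \<open>The nonzero vectors of U are distributed over its points, and each point holds q - 1 of
  them, where q is the order of the field.\<close>

lemma card_points_of:
  fixes U :: "('a::{field,finite} ^ 'n::finite) set"
  assumes U: "vec.subspace U"
  shows "card (points_of U) = (CARD('a) ^ vec.dim U - 1) div (CARD('a) - 1)"
proof -
  have "U - {0} = (\<Union>x\<in>points_of U. x - {0})"
  proof
    show "U - {0} \<subseteq> (\<Union>x\<in>points_of U. x - {0})"
    proof
      fix v assume v: "v \<in> U - {0}"
      then have "vec.span {v} \<in> points_of U"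
        using U by (simp add: points_of_def span_singleton_proj_point vec.span_minimal)
      with v show "v \<in> (\<Union>x\<in>points_of U. x - {0})"
        by (force intro: vec.span_base)
    qed
  qed (auto simp: points_of_def)
  also have "card \<dots> = (\<Sum>x\<in>points_of U. card (x - {0}))"
  proof (rule card_UN_disjoint)
    show "\<forall>x\<in>points_of U. \<forall>y\<in>points_of U. x \<noteq> y \<longrightarrow> (x - {0}) \<inter> (y - {0}) = {}"
      \<comment> \<open>Two points sharing a nonzero v are both equal to
        \<open>vec.span {v}\<close>.\<close>
      unfolding points_of_def using proj_point_eq_span by blast
  qed auto
  also have "\<dots> = (\<Sum>x\<in>points_of U. CARD('a) - 1)"
  proof (rule sum.cong)
    fix x assume "x \<in> points_of U"
    then have "vec.subspace x" "vec.dim x = 1"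
      by (auto simp: points_of_def proj_points_def proj_dim_def)
    then show "card (x - {0}) = CARD('a) - 1"
      using card_subspace[of x] by (simp add: vec.subspace_0)
  qed simp
  finally have "card U - 1 = card (points_of U) * (CARD('a) - 1)"
    using U by (simp add: vec.subspace_0)
  then show ?thesis
    using two_le_card_field[where 'a = 'a] by (simp add: card_subspace[OF U])
qed

lemma points_of_Int: "points_of (U \<inter> W) = points_of U \<inter> points_of W"
  by (auto simp: points_of_def)

section \<open>Polarities\<close>

lemma polarity_subspace: "polarity \<zeta> \<Longrightarrow> vec.subspace U \<Longrightarrow> vec.subspace (\<zeta> U)"
  and polarity_invol: "polarity \<zeta> \<Longrightarrow> vec.subspace U \<Longrightarrow> \<zeta> (\<zeta> U) = U"
  and polarity_antimono:
    "polarity \<zeta> \<Longrightarrow> vec.subspace U \<Longrightarrow> vec.subspace W \<Longrightarrow> U \<subseteq> W \<Longrightarrow> \<zeta> W \<subseteq> \<zeta> U"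
  by (auto simp: polarity_def)

lemma polarity_subset_swap:
  assumes "polarity \<zeta>" "vec.subspace U" "vec.subspace W"
  shows "W \<subseteq> \<zeta> U \<longleftrightarrow> U \<subseteq> \<zeta> W"
  using assms polarity_antimono[OF assms(1)] polarity_subspace[OF assms(1)]
  by (metis polarity_invol)

text \<open>The inclusion from right to left is a Galois argument: the meet M of the images
  satisfies U, W \<subseteq> \<zeta> M, hence so does their join, and swapping back places M inside
  the image of the join.\<close>

lemma polarity_span_Un:
  assumes \<zeta>: "polarity \<zeta>" and U: "vec.subspace U" and W: "vec.subspace W"
  shows "\<zeta> (vec.span (U \<union> W)) = \<zeta> U \<inter> \<zeta> W"
proof
  show "\<zeta> (vec.span (U \<union> W)) \<subseteq> \<zeta> U \<inter> \<zeta> W"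
    using assms by (simp add: polarity_antimono vec.span_superset order_trans[OF _ vec.span_superset])
  let ?M = "\<zeta> U \<inter> \<zeta> W"
  have M: "vec.subspace ?M"
    using assms by (simp add: polarity_subspace vec.subspace_inter)
  then have "U \<union> W \<subseteq> \<zeta> ?M"
    using assms polarity_subset_swap[OF \<zeta>, of _ ?M] by blast
  then have "vec.span (U \<union> W) \<subseteq> \<zeta> ?M"
    using M \<zeta> by (simp add: vec.span_minimal polarity_subspace)
  then show "?M \<subseteq> \<zeta> (vec.span (U \<union> W))"
    using M \<zeta> polarity_subset_swap by blast
qed

text \<open>Whenever U gains one dimension, its image loses at least one, because \<zeta> is
  injective on subspaces. An inequality suffices: applied to {0} \<subseteq> U and to U \<subseteq>
  UNIV it bounds the same sum from both sides in \<open>polarity_dim\<close>.\<close>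

lemma polarity_dim_mono:
  fixes \<zeta> :: "('a::field ^ 'n::finite) set \<Rightarrow> ('a ^ 'n) set"
  assumes \<zeta>: "polarity \<zeta>" and U: "vec.subspace U" and W: "vec.subspace W" and "U \<subseteq> W"
  shows "vec.dim (\<zeta> W) + vec.dim W \<le> vec.dim (\<zeta> U) + vec.dim U"
  using U \<open>U \<subseteq> W\<close>
proof (induction "vec.dim W - vec.dim U" arbitrary: U)
  case 0
  \<comment> \<open>The vanishing natural-number difference says only that dim W \<le> dim U;
    together with U \<subseteq> W this forces equality.\<close>
  then have "U = W"
    using W by (intro vec.subspace_dim_equal) auto
  then show ?case by simp
next
  case (Suc k)
  then obtain v where v: "v \<in> W" "v \<notin> U"
    by (metis Suc_neq_Zero diff_self_eq_0 subsetI subset_antisym)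
  let ?U = "vec.span (insert v U)"
  have dimU: "vec.dim ?U = vec.dim U + 1"
    using v Suc.prems by (simp add: vec.dim_insert vec.span_eq_iff[THEN iffD2])
  have "?U \<subseteq> W"
    using v Suc.prems W by (intro vec.span_minimal) auto
  moreover have "k = vec.dim W - vec.dim ?U"
    using Suc.hyps(2) dimU by simp
  ultimately have IH: "vec.dim (\<zeta> W) + vec.dim W \<le> vec.dim (\<zeta> ?U) + vec.dim ?U"
    by (intro Suc.hyps(1)) auto
  have "U \<subseteq> ?U"
    using vec.span_superset by blast
  then have sub: "\<zeta> ?U \<subseteq> \<zeta> U"
    using \<zeta> Suc.prems by (simp add: polarity_antimono)
  have "?U \<noteq> U"
    using dimU by (metis add_cancel_right_right zero_neq_one)
  then have "\<zeta> ?U \<noteq> \<zeta> U"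
    using \<zeta> Suc.prems(1) by (metis polarity_invol vec.subspace_span)
  then have "vec.dim (\<zeta> ?U) < vec.dim (\<zeta> U)"
    using sub \<zeta> Suc.prems(1)
    by (metis linorder_not_less polarity_subspace vec.subspace_dim_equal vec.subspace_span)
  with IH dimU show ?case by simp
qed

lemma polarity_dim:
  fixes \<zeta> :: "('a::field ^ 'n::finite) set \<Rightarrow> ('a ^ 'n) set"
  assumes \<zeta>: "polarity \<zeta>" and U: "vec.subspace U"
  shows "vec.dim (\<zeta> U) + vec.dim U = CARD('n)"
proof (rule antisym)
  have "vec.dim (\<zeta> {0}) \<le> CARD('n)"
    by (rule dim_subset_UNIV_cart_gen)
  then show "vec.dim (\<zeta> U) + vec.dim U \<le> CARD('n)"
    using polarity_dim_mono[OF \<zeta> vec.subspace_single_0 U] U by (simp add: vec.subspace_0)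
  show "CARD('n) \<le> vec.dim (\<zeta> U) + vec.dim U"
    using polarity_dim_mono[OF \<zeta> U vec.subspace_UNIV] by (simp add: card_cart_basis)
qed

section \<open>Dimensions of meets with the hyperplane of a point\<close>

lemma dim_span_Un_proj_point:
  fixes U :: "('a::field ^ 'n::finite) set"
  assumes "vec.subspace U" "x \<in> proj_points" "\<not> x \<subseteq> U"
  shows "vec.dim (vec.span (U \<union> x)) = vec.dim U + 1"
proof -
  obtain v where v: "v \<noteq> 0" "x = vec.span {v}"
    using assms proj_point_obtain by blast
  have "v \<notin> U"
    using assms v vec.span_minimal[of "{v}" U] by auto
  moreover have "vec.span (U \<union> x) = vec.span (insert v U)"
    unfolding v using vec.span_Un[of U "vec.span {v}"] vec.span_Un[of U "{v}"]
    by (simp add: vec.span_span)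
  ultimately show ?thesis
    using assms by (simp add: vec.dim_insert vec.span_eq_iff[THEN iffD2])
qed

text \<open>The meet is the image of the join of U and x, whose dimension is dim U + 1. It is
  applied with U a point and with U a spread element.\<close>

lemma dim_polarity_Int_proj_point:
  fixes \<zeta> :: "('a::field ^ 'n::finite) set \<Rightarrow> ('a ^ 'n) set"
  assumes "polarity \<zeta>" "vec.subspace U" "x \<in> proj_points" "\<not> x \<subseteq> U"
  shows "vec.dim (\<zeta> U \<inter> \<zeta> x) = CARD('n) - vec.dim U - 1"
proof -
  have "vec.subspace x"
    using assms by (simp add: proj_points_def)
  then show ?thesis
    using assms polarity_dim[of \<zeta> "vec.span (U \<union> x)"] dim_span_Un_proj_point[of U x]
    by (simp add: polarity_span_Un)
qed

text \<open>U lies in its image, and both have half the dimension of the whole space.\<close>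

lemma totally_isotropic_polarity_eq:
  fixes \<zeta> :: "('a::field ^ 'n::finite) set \<Rightarrow> ('a ^ 'n) set"
  assumes "polarity \<zeta>" "totally_isotropic \<zeta> U" "2 * vec.dim U = CARD('n)"
  shows "\<zeta> U = U"
  using assms polarity_dim[of \<zeta> U]
  by (intro vec.subspace_dim_equal[symmetric]) (auto simp: totally_isotropic_def polarity_subspace)

section \<open>The graph\<close>

lemma symplectic_spread_obtain:
  assumes "symplectic_spread \<zeta> e R" "x \<in> proj_points"
  obtains S where "S \<in> R" "x \<subseteq> S"
proof -
  have "x \<in> \<Union>(points_of ` R)"
    using assms by (simp add: symplectic_spread_def partition_on_def)
  with that show ?thesis
    by (auto simp: points_of_def)
qed

text \<open>The partition consists of the sets \<open>points_of S\<close>, so these, and not the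
  subspaces S and T, are what is compared.\<close>

lemma symplectic_spread_disjoint:
  assumes "symplectic_spread \<zeta> e R" "S \<in> R" "T \<in> R" "x \<in> proj_points" "x \<subseteq> S" "x \<subseteq> T"
  shows "points_of S = points_of T"
proof (rule ccontr)
  assume "points_of S \<noteq> points_of T"
  moreover have "disjoint (points_of ` R)"
    using assms by (simp add: symplectic_spread_def partition_on_def)
  ultimately have "points_of S \<inter> points_of T = {}"
    using assms by (simp add: disjointD)
  with assms show False
    by (auto simp: points_of_def)
qed

lemma neighbours_spread_removed_graph:
  assumes \<zeta>: "polarity \<zeta>" and R: "symplectic_spread \<zeta> e R"
    and S: "S \<in> R" and x: "x \<in> points_of S"
  shows "neighbours (spread_removed_graph \<zeta> R) x = points_of (\<zeta> x) - points_of S"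
proof -
  have xp: "x \<in> proj_points" "x \<subseteq> S"
    using x by (auto simp: points_of_def)
  have sub: "vec.subspace y" if "y \<in> proj_points" for y :: "('a ^ 'b) set"
    using that by (simp add: proj_points_def)
  \<comment> \<open>An edge is an unordered pair, whereas y \<subseteq> \<zeta> x is not visibly
    symmetric; \<open>polarity_subset_swap\<close> supplies the symmetry.\<close>
  have edge: "{x, y} \<in> snd (symplectic_graph \<zeta>) \<longleftrightarrow> x \<noteq> y \<and> y \<subseteq> \<zeta> x" if "y \<in> proj_points" for y
    using that xp polarity_subset_swap[OF \<zeta> sub sub, of x y]
    by (auto simp: symplectic_graph_def doubleton_eq_iff)
  have clique: "{x, y} \<in> (\<Union>U\<in>R. clique_edges (points_of U)) \<longleftrightarrow> x \<noteq> y \<and> y \<in> points_of S" for y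
  proof
    assume "{x, y} \<in> (\<Union>U\<in>R. clique_edges (points_of U))"
    then obtain U where U: "U \<in> R" "x \<in> points_of U" "y \<in> points_of U" "x \<noteq> y"
      by (auto simp: clique_edges_def doubleton_eq_iff)
    \<comment> \<open>Both classes contain x, so only the clique of S can remove edges at x.\<close>
    moreover have "points_of U = points_of S"
      using U xp by (intro symplectic_spread_disjoint[OF R _ S]) (auto simp: points_of_def)
    ultimately show "x \<noteq> y \<and> y \<in> points_of S" by simp
  qed (use S x in \<open>auto simp: clique_edges_def\<close>)
  have "neighbours (spread_removed_graph \<zeta> R) x
      = {y \<in> proj_points. (x \<noteq> y \<and> y \<subseteq> \<zeta> x) \<and> \<not> (x \<noteq> y \<and> y \<in> points_of S)}"
    unfolding neighbours_def spread_removed_graph_def fst_conv snd_conv Diff_iff clique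
    using edge by (auto simp: symplectic_graph_def)
  \<comment> \<open>The condition x \<noteq> y disappears because x itself belongs to
    \<open>points_of S\<close>.\<close>
  also have "\<dots> = points_of (\<zeta> x) - points_of S"
    using x by (auto simp: points_of_def)
  finally show ?thesis .
qed

lemma simple_graph_spread_removed_graph:
  fixes \<zeta> :: "('a::{field,finite} ^ 'n::finite) set \<Rightarrow> ('a ^ 'n) set"
  shows "simple_graph (spread_removed_graph \<zeta> R)"
  unfolding simple_graph_def spread_removed_graph_def symplectic_graph_def
  by (clarsimp simp: card_2_iff) blast

theorem theorem6:
  fixes q e :: nat
    and \<zeta> :: "('a::{field,finite} ^ 'n::finite) set \<Rightarrow> ('a ^ 'n) set"
    and R :: "('a ^ 'n) set set"
  assumes "primepow q" and "CARD('a) = q"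
    and "e \<ge> 2" and "CARD('n) = 2 * e"
    and "symplectic_polarity \<zeta>"
    and "symplectic_spread \<zeta> e R"
  shows "divisible_design_graph (spread_removed_graph \<zeta> R)
           ((q ^ (2 * e) - 1) div (q - 1))
           (q ^ e * ((q ^ (e - 1) - 1) div (q - 1)))
           (q ^ e * ((q ^ (e - 2) - 1) div (q - 1)))
           ((q ^ (e - 1) - 1)\<^sup>2 div (q - 1))
           (q ^ e + 1)
           ((q ^ e - 1) div (q - 1))"
proof -
  let ?G = "spread_removed_graph \<zeta> R"
  \<comment> \<open>\<theta> k is the number of points of a subspace of vector space dimension k, so
    \<theta> 0 = 0 and \<theta> 1 = 1.\<close>
  define \<theta> where "\<theta> k = (q ^ k - 1) div (q - 1)" for k
  note R = \<open>symplectic_spread \<zeta> e R\<close>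
  have q: "q \<ge> 2"
    using assms(2) two_le_card_field by metis
  have \<theta>_add: "\<theta> (a + b) = \<theta> a + q ^ a * \<theta> b" for a b
    unfolding \<theta>_def by (rule geometric_quotient_add[OF q])
  have \<zeta>: "polarity \<zeta>"
    using assms(5) by (simp add: symplectic_polarity_def)
  have sub_pt: "vec.subspace x" and dim_pt: "vec.dim x = 1" if "x \<in> proj_points" for x :: "('a ^ 'n) set"
    using that by (auto simp: proj_points_def proj_dim_def)
  have card_pts: "card (points_of U) = \<theta> (vec.dim U)" if "vec.subspace U" for U :: "('a ^ 'n) set"
    using card_points_of[OF that] assms(2) by (simp add: \<theta>_def)
  have sub: "vec.subspace U" and iso: "totally_isotropic \<zeta> U" and dim: "vec.dim U = e" if "U \<in> R" for U
    using R that by (auto simp: symplectic_spread_def totally_isotropic_def proj_dim_def)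
  have self: "\<zeta> U = U" if "U \<in> R" for U
    using totally_isotropic_polarity_eq[OF \<zeta> iso[OF that]] dim[OF that] assms(4) by simp
  have card_cl: "card (points_of U) = \<theta> e" if "U \<in> R" for U
    using card_pts[OF sub[OF that]] dim[OF that] by simp
  have part: "partition_on proj_points (points_of ` R)"
    using R by (simp add: symplectic_spread_def)
  have V: "fst ?G = proj_points"
    by (simp add: spread_removed_graph_def symplectic_graph_def)
  have "points_of UNIV = (proj_points :: ('a ^ 'n) set set)"
    by (auto simp: points_of_def)
  then have card_V: "card (proj_points :: ('a ^ 'n) set set) = \<theta> (2 * e)"
    using card_pts[OF vec.subspace_UNIV] assms(4) by (simp add: card_cart_basis)
  have nbr: "neighbours ?G x = points_of (\<zeta> x) - points_of S" if "S \<in> R" "x \<in> points_of S" for x S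
    using neighbours_spread_removed_graph[OF \<zeta> R that] .
  \<comment> \<open>From x \<subseteq> S follows S = \<zeta> S \<subseteq> \<zeta> x. Removing the
    points of S thus lowers the counts below by exactly \<theta> e.\<close>
  have perp: "points_of S \<subseteq> points_of (\<zeta> x)" if "S \<in> R" "x \<in> points_of S" for x S
    using that polarity_antimono[OF \<zeta> sub_pt sub, of x S] self[of S] by (auto simp: points_of_def)
  have perp2: "vec.dim (\<zeta> x \<inter> \<zeta> y) = 2 * e - 2"
    if xy: "x \<in> proj_points" "y \<in> proj_points" "x \<noteq> y" for x y
  proof -
    have "\<not> y \<subseteq> x"
      using xy vec.subspace_dim_equal[of y x] sub_pt dim_pt by auto
    then show ?thesis
      using dim_polarity_Int_proj_point[OF \<zeta> sub_pt[OF xy(1)] xy(2)] dim_pt xy assms(4) by simp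
  qed
  have card_perp2: "card (points_of (\<zeta> x) \<inter> points_of (\<zeta> y)) = \<theta> (2 * e - 2)"
    if "x \<in> proj_points" "y \<in> proj_points" "x \<noteq> y" for x y
    using perp2[OF that] card_pts[of "\<zeta> x \<inter> \<zeta> y"] that \<zeta>
    by (simp add: points_of_Int polarity_subspace vec.subspace_inter sub_pt)
  have "card (neighbours ?G x) = q ^ e * \<theta> (e - 1)" if x: "x \<in> proj_points" for x
  proof -
    obtain S where S: "S \<in> R" "x \<subseteq> S"
      using symplectic_spread_obtain[OF R x] by blast
    then have xS: "x \<in> points_of S"
      using x by (simp add: points_of_def)
    \<comment> \<open>The dimension 2e - 1 is split off at e so that \<open>\<theta>_add\<close>
      produces the summand \<theta> e, which the points of S cancel.\<close>
    have "vec.dim (\<zeta> x) = e + (e - 1)"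
      using polarity_dim[OF \<zeta> sub_pt[OF x]] dim_pt[OF x] assms(3,4) by simp
    then have "card (points_of (\<zeta> x)) = \<theta> (e + (e - 1))"
      using card_pts[OF polarity_subspace[OF \<zeta> sub_pt[OF x]]] by simp
    then show ?thesis
      using nbr[OF S(1) xS] perp[OF S(1) xS] card_cl[OF S(1)] by (simp add: card_Diff_subset \<theta>_add)
  qed
  then have regular: "regular_graph ?G (q ^ e * \<theta> (e - 1))"
    by (simp add: regular_graph_def V)
  have same: "card (neighbours ?G x \<inter> neighbours ?G y) = q ^ e * \<theta> (e - 2)"
    if S: "S \<in> R" and xy: "x \<in> points_of S" "y \<in> points_of S" "x \<noteq> y" for S x y
  proof -
    have "neighbours ?G x \<inter> neighbours ?G y = points_of (\<zeta> x) \<inter> points_of (\<zeta> y) - points_of S"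
      using nbr[OF S] xy by blast
    \<comment> \<open>Writing 2e - 2 in this way relies on e \<ge> 2, since the subtraction is
      truncated.\<close>
    moreover have "card (points_of (\<zeta> x) \<inter> points_of (\<zeta> y)) = \<theta> (e + (e - 2))"
      using card_perp2[of x y] xy assms(3) by (simp add: points_of_def mult_2)
    moreover have "points_of S \<subseteq> points_of (\<zeta> x) \<inter> points_of (\<zeta> y)"
      using perp[OF S] xy by blast
    ultimately show ?thesis
      using card_cl[OF S] by (simp add: card_Diff_subset \<theta>_add)
  qed
  have different: "card (neighbours ?G x \<inter> neighbours ?G y) = (q ^ (e - 1) - 1)\<^sup>2 div (q - 1)"
    if S: "S \<in> R" "T \<in> R" "points_of S \<noteq> points_of T" and xy: "x \<in> points_of S" "y \<in> points_of T"
    for S T x y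
  proof -
    have disj: "points_of S \<inter> points_of T = {}"
      using symplectic_spread_disjoint[OF R S(1,2)] S(3) by (auto simp: points_of_def)
    \<comment> \<open>Since A = \<zeta> A, the meet of A with \<zeta> z is a meet of two images, and
      its dimension is 2e - e - 1.\<close>
    have meet: "card (points_of A \<inter> points_of (\<zeta> z)) = \<theta> (e - 1)"
      if A: "A \<in> R" and z: "z \<in> proj_points" "z \<notin> points_of A" for A z
    proof -
      have "vec.dim (A \<inter> \<zeta> z) = e - 1"
        using dim_polarity_Int_proj_point[OF \<zeta> sub[OF A] z(1)] z self[OF A] dim[OF A] assms(4)
        by (simp add: points_of_def)
      then show ?thesis
        using card_pts[of "A \<inter> \<zeta> z"] A z \<zeta>
        by (simp add: points_of_Int polarity_subspace vec.subspace_inter sub_pt sub)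
    qed
    have pts: "x \<in> proj_points" "y \<in> proj_points"
      using xy by (auto simp: points_of_def)
    let ?X = "points_of (\<zeta> x)" and ?Y = "points_of (\<zeta> y)"
    have "neighbours ?G x \<inter> neighbours ?G y
        = ?X \<inter> ?Y - (points_of S \<inter> ?Y \<union> points_of T \<inter> ?X)"
      using nbr S xy by blast
    \<comment> \<open>By \<open>perp\<close>, S lies in \<zeta> x and T in \<zeta> y, so each
      removed piece lies in both hyperplanes.\<close>
    moreover have "points_of S \<inter> ?Y \<union> points_of T \<inter> ?X \<subseteq> ?X \<inter> ?Y"
      using perp S xy by blast
    moreover have "card (points_of S \<inter> ?Y \<union> points_of T \<inter> ?X) = \<theta> (e - 1) + \<theta> (e - 1)"
    proof (subst card_Un_disjoint)
      have "x \<notin> points_of T" "y \<notin> points_of S"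
        using xy disj by blast+
      then show "card (points_of S \<inter> ?Y) + card (points_of T \<inter> ?X) = \<theta> (e - 1) + \<theta> (e - 1)"
        using meet S pts by simp
    qed (use disj in auto)
    \<comment> \<open>Here the split is at e - 1: it gives
      \<open>(1 + q ^ (e - 1)) * \<theta> (e - 1)\<close>, from which
      \<open>2 * \<theta> (e - 1)\<close> is subtracted.\<close>
    moreover have "card (?X \<inter> ?Y) = \<theta> ((e - 1) + (e - 1))"
    proof -
      have "2 * e - 2 = (e - 1) + (e - 1)" by simp
      then show ?thesis
        using card_perp2[OF pts] xy disj by auto
    qed
    ultimately have "card (neighbours ?G x \<inter> neighbours ?G y) = (q ^ (e - 1) - 1) * \<theta> (e - 1)"
      by (simp add: card_Diff_subset \<theta>_add diff_mult_distrib)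
    then show ?thesis
      \<comment> \<open>The outer factor may be moved under the division because q - 1 divides the
        numerator exactly.\<close>
      by (simp only: \<theta>_def power2_eq_square div_mult_swap[OF minus_one_dvd_power_minus_one])
  qed
  \<comment> \<open>The number of classes comes from counting all \<theta> (2e) points class by
    class and cancelling \<theta> e, which is positive because \<theta> 1 = 1 is one of its
    summands.\<close>
  have "card (points_of ` R) * \<theta> e = card (\<Union>(points_of ` R))"
  proof (subst card_Union_disjoint)
    show "disjoint (points_of ` R)"
      using part by (simp add: partition_on_def)
    have "(\<Sum>C\<in>points_of ` R. card C) = (\<Sum>C\<in>points_of ` R. \<theta> e)"
      using card_cl by (intro sum.cong) auto
    then show "card (points_of ` R) * \<theta> e = sum card (points_of ` R)" by simp
  qed auto
  also have "\<dots> = \<theta> (e + e)"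
    using part card_V by (simp add: partition_on_def mult_2)
  also have "\<dots> = (q ^ e + 1) * \<theta> e"
    by (simp add: \<theta>_add)
  moreover have "\<theta> e > 0"
    using q assms(3) \<theta>_add[of 1 "e - 1"] by (simp add: \<theta>_def)
  ultimately have card_P: "card (points_of ` R) = q ^ e + 1"
    by (metis mult_right_cancel less_not_refl)
  show ?thesis
    unfolding divisible_design_graph_def \<theta>_def[symmetric] V
  proof (intro conjI exI[of _ "points_of ` R"])
    show "simple_graph ?G"
      by (rule simple_graph_spread_removed_graph)
    show "\<forall>C\<in>points_of ` R. \<forall>x\<in>C. \<forall>y\<in>C. x \<noteq> y \<longrightarrow>
        card (neighbours ?G x \<inter> neighbours ?G y) = q ^ e * \<theta> (e - 2)"
      using same by blast
    show "\<forall>C\<in>points_of ` R. \<forall>D\<in>points_of ` R. C \<noteq> D \<longrightarrow> (\<forall>x\<in>C. \<forall>y\<in>D.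
        card (neighbours ?G x \<inter> neighbours ?G y) = (q ^ (e - 1) - 1)\<^sup>2 div (q - 1))"
      using different by blast
  qed (use card_V regular part card_P card_cl in auto)
qed

end
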